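(* Let $k\ge 2$ be a natural number. The hypercommutator of arity $k$ for an algebra is determined by the $k$-ary polynomials of the algebra. That is: if $\mathbb{A}$ and $\mathbb{B}$ are algebras with the same underlying set $A$ and with the same set of $k$-ary polynomial operations, $\mathrm{Pol}_k(\mathbb{A})=\mathrm{Pol}_k(\mathbb{B})$, then for every set $S\subseteq\mathbb{N}$ with $|S|=k$, the hypercommutator operations $\{\theta_i\}_{i\in S}\mapsto[\{\theta_i\}_{i\in S}]_H$ of $\mathbb{A}$ and of $\mathbb{B}$ are the same operation: $\mathrm{Con}(\mathbb{A})=\mathrm{Con}(\mathbb{B})$, and for every $S$-indexed family $\{\theta_i\}_{i\in S}$ of congruences, the value of $[\{\theta_i\}_{i\in S}]_H$ computed in $\mathbb{A}$ equals its value computed in $\mathbb{B}$.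
   Context: $2^S$ is the set of functions $S\to 2=\{0,1\}$. An element $\gamma\in A^{2^S}$ is a labeled $|S|$-dimensional cube with labels $\gamma_f$ ($f\in 2^S$). For $i\in S$, $j\in 2$, let $\mathrm{Faces}_i^j(\gamma)\in A^{2^{S\setminus\{i\}}}$ be given by $\mathrm{Faces}_i^j(\gamma)_g=\gamma_f$ where $f$ extends $g\in 2^{S\setminus\{i\}}$ by $f_i=j$. For $R\subseteq A^{2^S}$, $\mathrm{Faces}_i(R)=\{\langle\mathrm{Faces}_i^0(\gamma),\mathrm{Faces}_i^1(\gamma)\rangle:\gamma\in R\}$, a binary relation on $A^{2^{S\setminus\{i\}}}$. Let $\mathrm{Lines}_i(\gamma)\in(A^2)^{2^{S\setminus\{i\}}}$ be the cube labeled by pairs, $\mathrm{Lines}_i(\gamma)_g=\langle\mathrm{Faces}_i^0(\gamma)_g,\mathrm{Faces}_i^1(\gamma)_g\rangle$. A binary relation is a quasiequivalence relation if it is quasireflexive ($\langle a,b\rangle\in R$ implies $\langle a,a\rangle,\langle b,b\rangle\in R$), symmetric and transitive. A relation $R\subseteq A^{2^S}$ is an $|S|$-dimensional congruence of an algebra $\mathbb{A}$ with underlying set $A$ if $\mathrm{Faces}_i(R)$ is a quasiequivalence relation for every $i\in S$ and $R$ is closed under the basic operations of $\mathbb{A}$ applied coordinatewise. $\Theta_S(X)$ is the intersection of all $|S|$-dimensional congruences of $\mathbb{A}$ containing $X\subseteq A^{2^S}$. For $i\in S$ and $x,y\in A$, $\mathrm{cube}_i(x,y)\in A^{2^S}$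 is given by $\mathrm{cube}_i(x,y)_f=x$ if $f_i=0$ and $y$ if $f_i=1$. For congruences $\{\theta_i\}_{i\in S}\subseteq\mathrm{Con}(\mathbb{A})$, set $\Delta(\{\theta_i\}_{i\in S})=\Theta_S\left(\bigcup_{i\in S}\mathrm{cube}_i(\theta_i)\right)$. For $\delta\in\mathrm{Con}(\mathbb{A})$, $|S|\ge 2$ and $i\in S$, a relation $R\subseteq A^{2^S}$ has $(\delta,i)$-centrality if there is no $\gamma\in R$ such that exactly $2^{|S|-1}-1$ many of the vertices of $\mathrm{Lines}_i(\gamma)$ are labeled by $\delta$-pairs (pairs belonging to $\delta$). With $m$ the greatest element of $S$, the $|S|$-ary hypercommutator is $[\{\theta_i\}_{i\in S}]_H=\bigcap\{\delta\in\mathrm{Con}(\mathbb{A}):\Delta(\{\theta_i\}_{i\in S})\text{ has }(\delta,m)\text{-centrality}\}$. $\mathrm{Pol}_k(\mathbb{A})$ is the set of $k$-ary polynomial operations of $\mathbb{A}$, i.e. $k$-ary operations obtained from term operations by substituting constants from $A$ for some of the arguments. *)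

theory Defs
  imports Main "HOL-Library.FuncSet"
begin

section \<open>Algebras, congruences, polynomial operations\<close>

text \<open>
  An \<open>n\<close>-tuple over \<open>A\<close> is an element of \<open>{..<n} \<rightarrow>\<^sub>E A\<close>, and an \<open>n\<close>-ary operation on \<open>A\<close> is a
  function on these tuples. The operation symbols form a subset of a type, so that an algebra may
  have no basic operations; an empty carrier is not excluded.
\<close>

abbreviation tuples :: "'a set \<Rightarrow> nat \<Rightarrow> (nat \<Rightarrow> 'a) set" where
  "tuples A n \<equiv> {..<n} \<rightarrow>\<^sub>E A"

record ('f, 'a) ualg =
  carrier :: "'a set"
  symbols :: "'f set"
  arity :: "'f \<Rightarrow> nat"
  interp :: "'f \<Rightarrow> (nat \<Rightarrow> 'a) \<Rightarrow> 'a"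

definition is_algebra :: "('f, 'a) ualg \<Rightarrow> bool" where
  "is_algebra \<A> \<longleftrightarrow>
     (\<forall>f\<in>symbols \<A>. \<forall>x\<in>tuples (carrier \<A>) (arity \<A> f). interp \<A> f x \<in> carrier \<A>)"

definition Con :: "('f, 'a) ualg \<Rightarrow> ('a \<times> 'a) set set" where
  "Con \<A> = {\<theta>. equiv (carrier \<A>) \<theta> \<and>
     (\<forall>f\<in>symbols \<A>. \<forall>x\<in>tuples (carrier \<A>) (arity \<A> f). \<forall>y\<in>tuples (carrier \<A>) (arity \<A> f).
        (\<forall>j<arity \<A> f. (x j, y j) \<in> \<theta>) \<longrightarrow> (interp \<A> f x, interp \<A> f y) \<in> \<theta>)}"

text \<open>
  Operations are restricted to tuples over the carrier, so that equality of HOL functions is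
  equality of operations.
\<close>

inductive_set term_ops :: "('f, 'a) ualg \<Rightarrow> nat \<Rightarrow> ((nat \<Rightarrow> 'a) \<Rightarrow> 'a) set"
  for \<A> :: "('f, 'a) ualg" and n :: nat where
  proj: "i < n \<Longrightarrow> (\<lambda>x\<in>tuples (carrier \<A>) n. x i) \<in> term_ops \<A> n"
| comp: "f \<in> symbols \<A> \<Longrightarrow> (\<And>j. j < arity \<A> f \<Longrightarrow> t j \<in> term_ops \<A> n) \<Longrightarrow>
    (\<lambda>x\<in>tuples (carrier \<A>) n. interp \<A> f (\<lambda>j\<in>{..<arity \<A> f}. t j x)) \<in> term_ops \<A> n"

text \<open>
  Term operations are closed under permuting their arguments, so the constants may be substituted
  for the last \<open>m\<close> arguments.
\<close>

definition Pol :: "nat \<Rightarrow> ('f, 'a) ualg \<Rightarrow> ((nat \<Rightarrow> 'a) \<Rightarrow> 'a) set" where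
  "Pol k \<A> = {p. \<exists>m. \<exists>t\<in>term_ops \<A> (k + m). \<exists>c\<in>tuples (carrier \<A>) m.
     p = (\<lambda>x\<in>tuples (carrier \<A>) k. t (\<lambda>j\<in>{..<k + m}. if j < k then x j else c (j - k)))}"


section \<open>Cubes and higher dimensional congruences\<close>

text \<open>\<open>2\<^sup>S\<close> and \<open>A\<close> to the power \<open>2\<^sup>S\<close>:\<close>

abbreviation vertices :: "nat set \<Rightarrow> (nat \<Rightarrow> nat) set" where
  "vertices S \<equiv> S \<rightarrow>\<^sub>E {0, 1}"

abbreviation cubes :: "nat set \<Rightarrow> 'a set \<Rightarrow> ((nat \<Rightarrow> nat) \<Rightarrow> 'a) set" where
  "cubes S A \<equiv> vertices S \<rightarrow>\<^sub>E A"

definition face :: "nat set \<Rightarrow> nat \<Rightarrow> nat \<Rightarrow> ((nat \<Rightarrow> nat) \<Rightarrow> 'a) \<Rightarrow> ((nat \<Rightarrow> nat) \<Rightarrow> 'a)" where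
  "face S i j \<gamma> = (\<lambda>g\<in>vertices (S - {i}). \<gamma> (g(i := j)))"

definition Faces :: "nat set \<Rightarrow> nat \<Rightarrow> ((nat \<Rightarrow> nat) \<Rightarrow> 'a) set \<Rightarrow>
    (((nat \<Rightarrow> nat) \<Rightarrow> 'a) \<times> ((nat \<Rightarrow> nat) \<Rightarrow> 'a)) set" where
  "Faces S i R = {(face S i 0 \<gamma>, face S i 1 \<gamma>) | \<gamma>. \<gamma> \<in> R}"

definition Lines :: "nat set \<Rightarrow> nat \<Rightarrow> ((nat \<Rightarrow> nat) \<Rightarrow> 'a) \<Rightarrow> ((nat \<Rightarrow> nat) \<Rightarrow> 'a \<times> 'a)" where
  "Lines S i \<gamma> = (\<lambda>g\<in>vertices (S - {i}). (face S i 0 \<gamma> g, face S i 1 \<gamma> g))"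

definition quasiequiv :: "('b \<times> 'b) set \<Rightarrow> bool" where
  "quasiequiv R \<longleftrightarrow> (\<forall>a b. (a, b) \<in> R \<longrightarrow> (a, a) \<in> R \<and> (b, b) \<in> R) \<and> sym R \<and> trans R"

definition dim_congruence :: "('f, 'a) ualg \<Rightarrow> nat set \<Rightarrow> ((nat \<Rightarrow> nat) \<Rightarrow> 'a) set \<Rightarrow> bool" where
  "dim_congruence \<A> S R \<longleftrightarrow>
     R \<subseteq> cubes S (carrier \<A>) \<and>
     (\<forall>i\<in>S. quasiequiv (Faces S i R)) \<and>
     (\<forall>f\<in>symbols \<A>. \<forall>\<gamma>\<in>tuples R (arity \<A> f).
        (\<lambda>v\<in>vertices S. interp \<A> f (\<lambda>j\<in>{..<arity \<A> f}. \<gamma> j v)) \<in> R)"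

definition Theta :: "('f, 'a) ualg \<Rightarrow> nat set \<Rightarrow> ((nat \<Rightarrow> nat) \<Rightarrow> 'a) set \<Rightarrow> ((nat \<Rightarrow> nat) \<Rightarrow> 'a) set" where
  "Theta \<A> S X = \<Inter>{R. dim_congruence \<A> S R \<and> X \<subseteq> R}"


section \<open>The hypercommutator\<close>

definition cube :: "nat set \<Rightarrow> nat \<Rightarrow> 'a \<Rightarrow> 'a \<Rightarrow> ((nat \<Rightarrow> nat) \<Rightarrow> 'a)" where
  "cube S i x y = (\<lambda>f\<in>vertices S. if f i = 0 then x else y)"

definition Delta :: "('f, 'a) ualg \<Rightarrow> nat set \<Rightarrow> (nat \<Rightarrow> ('a \<times> 'a) set) \<Rightarrow> ((nat \<Rightarrow> nat) \<Rightarrow> 'a) set" where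
  "Delta \<A> S \<theta> = Theta \<A> S (\<Union>i\<in>S. {cube S i x y | x y. (x, y) \<in> \<theta> i})"

definition centrality :: "nat set \<Rightarrow> ('a \<times> 'a) set \<Rightarrow> nat \<Rightarrow> ((nat \<Rightarrow> nat) \<Rightarrow> 'a) set \<Rightarrow> bool" where
  "centrality S \<delta> i R \<longleftrightarrow>
     \<not> (\<exists>\<gamma>\<in>R. card {g \<in> vertices (S - {i}). Lines S i \<gamma> g \<in> \<delta>} = 2 ^ (card S - 1) - 1)"

definition hypercommutator :: "('f, 'a) ualg \<Rightarrow> nat set \<Rightarrow> (nat \<Rightarrow> ('a \<times> 'a) set) \<Rightarrow> ('a \<times> 'a) set" where
  "hypercommutator \<A> S \<theta> = \<Inter>{\<delta> \<in> Con \<A>. centrality S \<delta> (Max S) (Delta \<A> S \<theta>)}"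

end

theory Submission
  imports Defs
begin

text \<open>
  The hypercommutator is computed from two things: the set of congruences, and the relation
  \<open>\<Delta>\<close>. Both are shown to be described by \<open>k\<close>-ary polynomials alone.

  For congruences this is the classical argument (\<open>Con_iff_Pol\<close>): an equivalence relation is
  compatible with a basic operation as soon as it is compatible with the unary polynomials that
  arise by fixing all arguments but one, because the arguments can be exchanged one at a time; and
  a unary polynomial is a \<open>k\<close>-ary one that ignores the other variables.

  For \<open>\<Delta>\<close>, start from the cubes \<open>v \<mapsto> p(z\<^sub>0, \<dots>, z\<^sub>k\<^sub>-\<^sub>1)\<close> where \<open>p\<close> is a \<open>k\<close>-ary polynomial and
  every \<open>z\<^sub>l\<close> is a generator \<open>cube\<^sub>i(x, y)\<close> evaluated at \<open>v\<close>. Close this set under pasting two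
  cubes along a common face, that is, under transitivity in all directions. The claim is that the
  result \<open>D\<close> is \<open>\<Delta>\<close> (\<open>Delta_eq_pasting_closure\<close>); since \<open>D\<close> mentions only the \<open>k\<close>-ary
  polynomials, this suffices. Every higher dimensional congruence that contains the generators
  contains \<open>D\<close>, so the point is that \<open>D\<close> is itself closed under the basic operations.
  Two observations give this.

  First, a cube can be pasted to its own degenerate face. Hence pasting in one argument of an
  operation commutes with the operation, provided that the other arguments are pasted to their
  degenerate faces, and it is enough to apply the operation to the cubes that \<open>D\<close> is generated
  from (\<open>pasting_closure_op\<close>).

  Second, applying an operation to such cubes gives a cube of the same shape, but of a polynomial
  in possibly more than \<open>k\<close> variables (\<open>poly_cubes_op\<close>). If more than \<open>k\<close> of its variables really
  vary, then two of them vary in the same direction \<open>i\<close>, as there are only \<open>k\<close> directions.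
  Moving first one of the two and then the other writes the cube as a pasting in direction \<open>i\<close> of
  two cubes in which fewer variables vary. By induction the cube is pasted together from cubes in
  which at most \<open>k\<close> variables vary, and the remaining variables are constants of the polynomial
  (\<open>poly_cube_in_pasting_closure\<close>).
\<close>

text \<open>
  The two coordinates of a vertex are the numerals \<open>0\<close> and \<open>1\<close>; rewriting \<open>1\<close> to a successor would
  separate \<open>{0, Suc 0}\<close> from the set of coordinates in the facts about vertices.
\<close>

declare One_nat_def [simp del]

section \<open>Polynomials in an arbitrary set of variables\<close>

text \<open>
  The variables may come from any type, and an assignment is a total function on it. Composing
  polynomials whose variables must be kept apart is then a matter of pairing indices, with no
  arithmetic on positions in tuples.
\<close>

inductive_set polynomials :: "('f, 'a) ualg \<Rightarrow> 'i set \<Rightarrow> (('i \<Rightarrow> 'a) \<Rightarrow> 'a) set"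
  for \<A> :: "('f, 'a) ualg" and I :: "'i set" where
  var: "i \<in> I \<Longrightarrow> (\<lambda>z. z i) \<in> polynomials \<A> I"
| const: "a \<in> carrier \<A> \<Longrightarrow> (\<lambda>z. a) \<in> polynomials \<A> I"
| comp: "f \<in> symbols \<A> \<Longrightarrow> (\<And>j. j < arity \<A> f \<Longrightarrow> t j \<in> polynomials \<A> I) \<Longrightarrow>
    (\<lambda>z. interp \<A> f (\<lambda>j\<in>{..<arity \<A> f}. t j z)) \<in> polynomials \<A> I"

lemma polynomials_cong:
  assumes "t \<in> polynomials \<A> I" and "\<And>i. i \<in> I \<Longrightarrow> z i = z' i"
  shows "t z = t z'"
  using assms(1)
proof induction
  case (comp f t)
  then have "(\<lambda>j\<in>{..<arity \<A> f}. t j z) = (\<lambda>j\<in>{..<arity \<A> f}. t j z')"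
    by (intro restrict_ext) auto
  then show ?case by simp
qed (use assms(2) in auto)

lemma polynomials_closed:
  assumes "is_algebra \<A>" and "t \<in> polynomials \<A> I" and "\<And>i. i \<in> I \<Longrightarrow> z i \<in> carrier \<A>"
  shows "t z \<in> carrier \<A>"
  using assms(2)
proof induction
  case (comp f t)
  then have "(\<lambda>j\<in>{..<arity \<A> f}. t j z) \<in> tuples (carrier \<A>) (arity \<A> f)"
    by (intro restrict_PiE_iff[THEN iffD2]) auto
  then show ?case using assms(1) comp.hyps by (auto simp: is_algebra_def)
qed (use assms(3) in auto)

lemma polynomials_subst:
  assumes "t \<in> polynomials \<A> N" and "\<And>l. l \<in> N \<Longrightarrow> s l \<in> polynomials \<A> I"
  shows "(\<lambda>z. t (\<lambda>l. s l z)) \<in> polynomials \<A> I"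
  using assms(1)
proof induction
  case (comp f t)
  then show ?case by (intro polynomials.comp) auto
qed (use assms(2) in \<open>auto intro: polynomials.const\<close>)

definition merge :: "nat \<Rightarrow> nat \<Rightarrow> (nat \<Rightarrow> 'a) \<Rightarrow> (nat \<Rightarrow> 'a) \<Rightarrow> (nat \<Rightarrow> 'a)" where
  "merge k m x c = (\<lambda>j\<in>{..<k + m}. if j < k then x j else c (j - k))"

lemma merge_tuples:
  "x \<in> tuples A k \<Longrightarrow> c \<in> tuples A m \<Longrightarrow> merge k m x c \<in> tuples A (k + m)"
  by (auto simp: merge_def PiE_iff)

lemma merge_nth:
  "i < k \<Longrightarrow> merge k m x c i = x i"
  "k \<le> i \<Longrightarrow> i < k + m \<Longrightarrow> merge k m x c i = c (i - k)"
  by (auto simp: merge_def)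

lemma Pol_merge:
  "Pol k \<A> = {p. \<exists>m. \<exists>t\<in>term_ops \<A> (k + m). \<exists>c\<in>tuples (carrier \<A>) m.
     p = (\<lambda>x\<in>tuples (carrier \<A>) k. t (merge k m x c))}"
  unfolding Pol_def merge_def ..

text \<open>
  A composition has to bring the constants of its parts into one tuple. For this reason the lemma
  does not choose the tuple of constants: a polynomial is represented by a term over \<^emph>\<open>every\<close>
  tuple that lists a certain finite set of elements, and for a composition one takes the union of
  the sets that belong to its parts.
\<close>

lemma polynomial_as_term:
  assumes "t \<in> polynomials \<A> {..<k}"
  shows "\<exists>C. finite C \<and> C \<subseteq> carrier \<A> \<and> (\<forall>m. \<forall>c\<in>tuples (carrier \<A>) m. C \<subseteq> c ` {..<m} \<longrightarrow>
    (\<exists>s\<in>term_ops \<A> (k + m). \<forall>x\<in>tuples (carrier \<A>) k.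
       s (merge k m x c) = t x))"
    (is "\<exists>C. ?rep t C")
  using assms
proof induction
  case (var i)
  have "\<exists>s\<in>term_ops \<A> (k + m). \<forall>x\<in>tuples (carrier \<A>) k.
       s (merge k m x c) = x i"
    if "c \<in> tuples (carrier \<A>) m" for m c
    using var that
    by (intro bexI[OF _ term_ops.proj[of i "k + m"]]) (auto simp: merge_tuples merge_nth)
  then show ?case by (intro exI[of _ "{}"]) simp
next
  case (const a)
  have "\<exists>s\<in>term_ops \<A> (k + m). \<forall>x\<in>tuples (carrier \<A>) k.
       s (merge k m x c) = a"
    if "c \<in> tuples (carrier \<A>) m" "i < m" "c i = a" for m c i
    using that
    by (intro bexI[OF _ term_ops.proj[of "k + i" "k + m"]]) (auto simp: merge_tuples merge_nth)
  then show ?case using const by (intro exI[of _ "{a}"]) (simp add: image_iff, blast)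
next
  case (comp f t)
  let ?n = "arity \<A> f"
  have "\<forall>j\<in>{..<?n}. \<exists>C. ?rep (t j) C" by (intro ballI comp.IH) simp
  then obtain C where "\<forall>j\<in>{..<?n}. ?rep (t j) (C j)"
    by (rule bchoice[THEN exE])
  then have C: "?rep (t j) (C j)" if "j < ?n" for j using that by simp
  have "\<exists>s\<in>term_ops \<A> (k + m). \<forall>x\<in>tuples (carrier \<A>) k.
       s (merge k m x c) = interp \<A> f (\<lambda>j\<in>{..<?n}. t j x)"
    if c: "c \<in> tuples (carrier \<A>) m" "(\<Union>j<?n. C j) \<subseteq> c ` {..<m}" for m c
  proof -
    have "\<forall>j\<in>{..<?n}. \<exists>s. s \<in> term_ops \<A> (k + m) \<and>
      (\<forall>x\<in>tuples (carrier \<A>) k. s (merge k m x c) = t j x)"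
    proof
      fix j assume "j \<in> {..<?n}"
      then have j: "j < ?n" by simp
      then have "C j \<subseteq> c ` {..<m}" using c(2) by blast
      then show "\<exists>s. s \<in> term_ops \<A> (k + m) \<and>
        (\<forall>x\<in>tuples (carrier \<A>) k. s (merge k m x c) = t j x)"
        using C[OF j] c(1) by blast
    qed
    then obtain s where "\<forall>j\<in>{..<?n}. s j \<in> term_ops \<A> (k + m) \<and>
      (\<forall>x\<in>tuples (carrier \<A>) k. s j (merge k m x c) = t j x)"
      by (rule bchoice[THEN exE])
    then have s: "\<And>j. j < ?n \<Longrightarrow> s j \<in> term_ops \<A> (k + m)"
      "\<And>j x. j < ?n \<Longrightarrow> x \<in> tuples (carrier \<A>) k \<Longrightarrow> s j (merge k m x c) = t j x"
      by simp_all
    show ?thesis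
      using c(1) s(2)
      by (intro bexI[OF _ term_ops.comp[OF comp.hyps(1) s(1)]])
        (auto simp: merge_tuples cong: restrict_cong)
  qed
  moreover have "finite (\<Union>j<?n. C j)" "(\<Union>j<?n. C j) \<subseteq> carrier \<A>" using C by blast+
  ultimately show ?case by (intro exI[of _ "\<Union>j<?n. C j"] conjI allI ballI impI)
qed

text \<open>
  The description of polynomial operations by one term and one tuple of constants agrees with the
  inductive one, which is the one used from here on.
\<close>

lemma Pol_eq: "Pol k \<A> = (\<lambda>t. \<lambda>x\<in>tuples (carrier \<A>) k. t x) ` polynomials \<A> {..<k}"
proof (intro equalityI subsetI)
  fix p assume "p \<in> Pol k \<A>"
  then obtain m t c where t: "t \<in> term_ops \<A> (k + m)" and c: "c \<in> tuples (carrier \<A>) m"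
    and p: "p = (\<lambda>x\<in>tuples (carrier \<A>) k. t (merge k m x c))"
    unfolding Pol_merge by blast
  let ?merge = "\<lambda>x. merge k m x c"
  have "\<exists>s\<in>polynomials \<A> {..<k}. \<forall>x\<in>tuples (carrier \<A>) k. s x = t (?merge x)"
    using t
  proof induction
    case (proj i)
    show ?case
    proof (cases "i < k")
      case True
      then show ?thesis using c
        by (intro bexI[OF _ polynomials.var[of i]]) (auto simp: merge_tuples merge_nth)
    next
      case False
      then have "c (i - k) \<in> carrier \<A>" using c proj by (auto simp: PiE_iff)
      then show ?thesis using c proj False
        by (intro bexI[OF _ polynomials.const[of "c (i - k)"]]) (auto simp: merge_tuples merge_nth)
    qed
  next
    case (comp f t)
    then have "\<forall>j\<in>{..<arity \<A> f}. \<exists>s. s \<in> polynomials \<A> {..<k} \<and>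
      (\<forall>x\<in>tuples (carrier \<A>) k. s x = t j (?merge x))"
      by blast
    then obtain s where "\<forall>j\<in>{..<arity \<A> f}. s j \<in> polynomials \<A> {..<k} \<and>
      (\<forall>x\<in>tuples (carrier \<A>) k. s j x = t j (?merge x))"
      by (rule bchoice[THEN exE])
    then have s: "\<And>j. j < arity \<A> f \<Longrightarrow> s j \<in> polynomials \<A> {..<k}"
      "\<And>j x. j < arity \<A> f \<Longrightarrow> x \<in> tuples (carrier \<A>) k \<Longrightarrow> s j x = t j (?merge x)"
      by simp_all
    show ?case
      using c s(2)
      by (intro bexI[OF _ polynomials.comp[OF comp.hyps(1) s(1)]])
        (auto simp: merge_tuples cong: restrict_cong)
  qed
  then obtain s where s: "s \<in> polynomials \<A> {..<k}"
    "\<And>x. x \<in> tuples (carrier \<A>) k \<Longrightarrow> s x = t (?merge x)"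
    by blast
  have "p = (\<lambda>x\<in>tuples (carrier \<A>) k. s x)"
    unfolding p by (rule restrict_ext) (simp add: s(2))
  then show "p \<in> (\<lambda>t. \<lambda>x\<in>tuples (carrier \<A>) k. t x) ` polynomials \<A> {..<k}"
    using s(1) by blast
next
  fix p assume "p \<in> (\<lambda>t. \<lambda>x\<in>tuples (carrier \<A>) k. t x) ` polynomials \<A> {..<k}"
  then obtain t where t: "t \<in> polynomials \<A> {..<k}" and p: "p = (\<lambda>x\<in>tuples (carrier \<A>) k. t x)"
    by blast
  obtain C where C: "finite C" "C \<subseteq> carrier \<A>" and rep: "\<forall>m. \<forall>c\<in>tuples (carrier \<A>) m.
    C \<subseteq> c ` {..<m} \<longrightarrow> (\<exists>s\<in>term_ops \<A> (k + m). \<forall>x\<in>tuples (carrier \<A>) k.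
       s (merge k m x c) = t x)"
    using polynomial_as_term[OF t] by (elim exE conjE) (rule that)
  obtain h where h: "bij_betw h {..<card C} C"
    using ex_bij_betw_nat_finite[OF C(1)] atLeast0LessThan by auto
  define c where "c = restrict h {..<card C}"
  have c: "c \<in> tuples (carrier \<A>) (card C)" "C \<subseteq> c ` {..<card C}"
    using h C(2) unfolding c_def by (auto simp: bij_betw_def)
  obtain s where s: "s \<in> term_ops \<A> (k + card C)" "\<forall>x\<in>tuples (carrier \<A>) k.
       s (merge k (card C) x c) = t x"
    using rep[rule_format, OF c] by blast
  then have "p = (\<lambda>x\<in>tuples (carrier \<A>) k.
       s (merge k (card C) x c))"
    unfolding p by (intro restrict_ext) auto
  then show "p \<in> Pol k \<A>"
    unfolding Pol_merge using s c(1) by blast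
qed

section \<open>Congruences\<close>

lemma polynomials_preserve_congruence:
  assumes \<theta>: "\<theta> \<in> Con \<A>" and t: "t \<in> polynomials \<A> I"
    and xy: "\<And>i. i \<in> I \<Longrightarrow> (x i, y i) \<in> \<theta>"
  shows "(t x, t y) \<in> \<theta>"
  using t
proof induction
  case (const a)
  then show ?case using \<theta> by (auto simp: Con_def equiv_def refl_on_def)
next
  case (comp f t)
  have "\<theta> \<subseteq> carrier \<A> \<times> carrier \<A>"
    using \<theta> by (auto simp: Con_def equiv_def refl_on_def)
  then have "(\<lambda>j\<in>{..<arity \<A> f}. t j x) \<in> tuples (carrier \<A>) (arity \<A> f)"
    "(\<lambda>j\<in>{..<arity \<A> f}. t j y) \<in> tuples (carrier \<A>) (arity \<A> f)"
    using comp.IH by auto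
  then show ?case using \<theta> comp by (auto simp: Con_def)
qed (use xy in auto)

text \<open>
  From the polynomials back to a basic operation \<open>f\<close>: the arguments \<open>x\<close> are turned into \<open>y\<close> from
  left to right, and each exchange is an instance of a polynomial in the variable \<open>0\<close>, which
  exists because \<open>k > 0\<close>.
\<close>

lemma Con_iff_Pol:
  assumes alg: "is_algebra \<A>" and k: "k > 0"
  shows "\<theta> \<in> Con \<A> \<longleftrightarrow> equiv (carrier \<A>) \<theta> \<and>
    (\<forall>p\<in>Pol k \<A>. \<forall>x\<in>tuples (carrier \<A>) k. \<forall>y\<in>tuples (carrier \<A>) k.
       (\<forall>j<k. (x j, y j) \<in> \<theta>) \<longrightarrow> (p x, p y) \<in> \<theta>)"
    (is "_ \<longleftrightarrow> _ \<and> ?pol")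
proof (intro iffI)
  assume \<theta>: "\<theta> \<in> Con \<A>"
  have ?pol
  proof (intro ballI impI)
    fix p x y
    assume p: "p \<in> Pol k \<A>" and xy: "x \<in> tuples (carrier \<A>) k" "y \<in> tuples (carrier \<A>) k"
      and eq: "\<forall>j<k. (x j, y j) \<in> \<theta>"
    obtain t where "t \<in> polynomials \<A> {..<k}" "p = (\<lambda>x\<in>tuples (carrier \<A>) k. t x)"
      using p unfolding Pol_eq by blast
    then show "(p x, p y) \<in> \<theta>"
      using xy eq polynomials_preserve_congruence[OF \<theta>, of t "{..<k}" x y] by simp
  qed
  moreover have "equiv (carrier \<A>) \<theta>" using \<theta> by (simp add: Con_def)
  ultimately show "equiv (carrier \<A>) \<theta> \<and> ?pol" by (intro conjI)
next
  assume asm: "equiv (carrier \<A>) \<theta> \<and> ?pol"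
  from asm have eq: "equiv (carrier \<A>) \<theta>" by (rule conjunct1)
  from asm have pol: ?pol by (rule conjunct2)
  have "(interp \<A> f x, interp \<A> f y) \<in> \<theta>"
    if f: "f \<in> symbols \<A>" and x: "x \<in> tuples (carrier \<A>) (arity \<A> f)"
      and y: "y \<in> tuples (carrier \<A>) (arity \<A> f)" and xy: "\<And>j. j < arity \<A> f \<Longrightarrow> (x j, y j) \<in> \<theta>"
    for f x y
  proof -
    let ?n = "arity \<A> f"
    let ?mix = "\<lambda>m. \<lambda>j\<in>{..<?n}. if j < m then y j else x j"
    have "(interp \<A> f x, interp \<A> f (?mix m)) \<in> \<theta>" if "m \<le> ?n" for m
      using that
    proof (induction m)
      case 0
      have "?mix 0 = x" using x by auto
      moreover have "interp \<A> f x \<in> carrier \<A>" using alg f x by (auto simp: is_algebra_def)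
      ultimately show ?case using eq by (auto simp: equiv_def refl_on_def)
    next
      case (Suc m)
      \<comment> \<open>the polynomial \<open>f(y\<^sub>0, \<dots>, y\<^sub>m\<^sub>-\<^sub>1, z, x\<^sub>m\<^sub>+\<^sub>1, \<dots>)\<close> in the variable \<open>z = z\<^sub>0\<close>\<close>
      define s :: "nat \<Rightarrow> (nat \<Rightarrow> 'b) \<Rightarrow> 'b" where
        "s j = (if j = m then (\<lambda>z. z 0) else if j < m then (\<lambda>z. y j) else (\<lambda>z. x j))" for j
      have s: "s j \<in> polynomials \<A> {..<k}" if "j < ?n" for j
      proof -
        have "x j \<in> carrier \<A>" "y j \<in> carrier \<A>" using that x y by auto
        then show ?thesis
          using k by (auto simp: s_def intro: polynomials.var polynomials.const)
      qed
      let ?u = "\<lambda>z. interp \<A> f (\<lambda>j\<in>{..<?n}. s j z)"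
      have u: "?u \<in> polynomials \<A> {..<k}"
        using f s by (rule polynomials.comp)
      have m: "m < ?n" using Suc by simp
      let ?x = "\<lambda>_\<in>{..<k}. x m" and ?y = "\<lambda>_\<in>{..<k}. y m"
      have xm: "?x \<in> tuples (carrier \<A>) k" "?y \<in> tuples (carrier \<A>) k"
        using x y m by auto
      let ?p = "\<lambda>z\<in>tuples (carrier \<A>) k. ?u z"
      have "?p \<in> Pol k \<A>" unfolding Pol_eq using u by (rule imageI)
      then have "(?p ?x, ?p ?y) \<in> \<theta>"
        by (rule pol[rule_format, OF _ xm]) (simp add: xy[OF m])
      then have "(?u ?x, ?u ?y) \<in> \<theta>"
        using xm by simp
      moreover have "(\<lambda>j\<in>{..<?n}. s j ?x) = ?mix m" "(\<lambda>j\<in>{..<?n}. s j ?y) = ?mix (Suc m)"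
        using k by (auto simp: s_def intro!: restrict_ext)
      ultimately have "(interp \<A> f (?mix m), interp \<A> f (?mix (Suc m))) \<in> \<theta>"
        by simp
      moreover have "(interp \<A> f x, interp \<A> f (?mix m)) \<in> \<theta>"
        by (rule Suc.IH) (use Suc.prems in simp)
      moreover have "trans \<theta>" using eq by (simp add: equiv_def)
      ultimately show ?case by (blast dest: transD)
    qed
    from this[OF order_refl] have "(interp \<A> f x, interp \<A> f (?mix ?n)) \<in> \<theta>" .
    moreover have "?mix ?n = y"
    proof
      fix j show "?mix ?n j = y j" using PiE_arb[OF y, of j] by simp
    qed
    ultimately show ?thesis by (simp only:)
  qed
  then show "\<theta> \<in> Con \<A>" unfolding Con_def using eq by blast
qed

section \<open>Faces and pasting of cubes\<close>

lemma vertex_upd: "v \<in> vertices S \<Longrightarrow> i \<in> S \<Longrightarrow> j \<in> {0, 1} \<Longrightarrow> v(i := j) \<in> vertices S"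
  by (auto simp: PiE_iff extensional_def)

lemma face_eq_iff:
  assumes "i \<in> S"
  shows "face S i j \<gamma> = face S i j' \<delta> \<longleftrightarrow> (\<forall>v\<in>vertices S. \<gamma> (v(i := j)) = \<delta> (v(i := j')))"
proof
  assume eq: "face S i j \<gamma> = face S i j' \<delta>"
  show "\<forall>v\<in>vertices S. \<gamma> (v(i := j)) = \<delta> (v(i := j'))"
  proof
    fix v assume "v \<in> vertices S"
    \<comment> \<open>a vertex of the face is extensional, hence undefined at \<open>i\<close>\<close>
    then have "v(i := undefined) \<in> vertices (S - {i})"
      by (auto simp: PiE_iff extensional_def)
    then show "\<gamma> (v(i := j)) = \<delta> (v(i := j'))"
      using fun_cong[OF eq, of "v(i := undefined)"] by (simp add: face_def)
  qed
next
  assume eq: "\<forall>v\<in>vertices S. \<gamma> (v(i := j)) = \<delta> (v(i := j'))"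
  show "face S i j \<gamma> = face S i j' \<delta>"
    unfolding face_def
  proof (intro restrict_ext)
    fix g assume g: "g \<in> vertices (S - {i})"
    then have "g(i := 0) \<in> vertices S"
      using assms by (auto simp: PiE_iff extensional_def)
    then show "\<gamma> (g(i := j)) = \<delta> (g(i := j'))"
      using eq[rule_format, of "g(i := 0)"] by simp
  qed
qed

lemma cube_eqI:
  assumes "i \<in> S" and "\<gamma> \<in> cubes S A" and "\<delta> \<in> cubes S A"
    and "face S i 0 \<gamma> = face S i 0 \<delta>" and "face S i 1 \<gamma> = face S i 1 \<delta>"
  shows "\<gamma> = \<delta>"
proof (rule PiE_ext[OF assms(2,3)])
  fix v assume v: "v \<in> vertices S"
  then have "v i \<in> {0, 1}" using assms(1) by auto
  then show "\<gamma> v = \<delta> v"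
    using assms(4,5) v unfolding face_eq_iff[OF assms(1)]
    by (metis empty_iff fun_upd_triv insert_iff)
qed

text \<open>
  The three closure properties of a quasiequivalence relation, read as operations on cubes. With
  the two faces in direction \<open>i\<close> taken as the ends of an edge, \<open>degen\<close> is the loop at one end,
  \<open>flip\<close> reverses the edge, and \<open>paste\<close> composes two edges that share an end.
\<close>

definition degen :: "nat set \<Rightarrow> nat \<Rightarrow> nat \<Rightarrow> ((nat \<Rightarrow> nat) \<Rightarrow> 'a) \<Rightarrow> ((nat \<Rightarrow> nat) \<Rightarrow> 'a)" where
  "degen S i j \<gamma> = (\<lambda>v\<in>vertices S. \<gamma> (v(i := j)))"

definition flip :: "nat set \<Rightarrow> nat \<Rightarrow> ((nat \<Rightarrow> nat) \<Rightarrow> 'a) \<Rightarrow> ((nat \<Rightarrow> nat) \<Rightarrow> 'a)" where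
  "flip S i \<gamma> = (\<lambda>v\<in>vertices S. \<gamma> (v(i := 1 - v i)))"

definition paste :: "nat set \<Rightarrow> nat \<Rightarrow> ((nat \<Rightarrow> nat) \<Rightarrow> 'a) \<Rightarrow> ((nat \<Rightarrow> nat) \<Rightarrow> 'a) \<Rightarrow> ((nat \<Rightarrow> nat) \<Rightarrow> 'a)"
  where "paste S i \<gamma> \<delta> = (\<lambda>v\<in>vertices S. if v i = 0 then \<gamma> v else \<delta> v)"

lemma face_degen: "i \<in> S \<Longrightarrow> j \<in> {0, 1} \<Longrightarrow> j' \<in> {0, 1} \<Longrightarrow> face S i j' (degen S i j \<gamma>) = face S i j \<gamma>"
  unfolding face_eq_iff by (simp add: degen_def vertex_upd)

lemma face_flip: "i \<in> S \<Longrightarrow> j \<in> {0, 1} \<Longrightarrow> face S i j (flip S i \<gamma>) = face S i (1 - j) \<gamma>"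
  unfolding face_eq_iff by (auto simp: flip_def vertex_upd)

lemma face_paste:
  assumes "i \<in> S"
  shows "face S i 0 (paste S i \<gamma> \<delta>) = face S i 0 \<gamma>"
    and "face S i 1 (paste S i \<gamma> \<delta>) = face S i 1 \<delta>"
  unfolding face_eq_iff[OF assms] using assms by (simp_all add: paste_def vertex_upd)

lemma paste_cubes: "\<gamma> \<in> cubes S A \<Longrightarrow> \<delta> \<in> cubes S A \<Longrightarrow> paste S i \<gamma> \<delta> \<in> cubes S A"
  by (auto simp: paste_def)

lemma FacesI: "\<gamma> \<in> R \<Longrightarrow> (face S i 0 \<gamma>, face S i 1 \<gamma>) \<in> Faces S i R"
  unfolding Faces_def by blast

lemma FacesE:
  assumes "(a, b) \<in> Faces S i R"
  obtains \<gamma> where "\<gamma> \<in> R" "a = face S i 0 \<gamma>" "b = face S i 1 \<gamma>"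
  using assms unfolding Faces_def by blast

lemma quasiequiv_FacesI:
  assumes i: "i \<in> S"
    and degen: "\<And>\<gamma> j. \<gamma> \<in> R \<Longrightarrow> j \<in> {0, 1} \<Longrightarrow> degen S i j \<gamma> \<in> R"
    and flip: "\<And>\<gamma>. \<gamma> \<in> R \<Longrightarrow> flip S i \<gamma> \<in> R"
    and paste: "\<And>\<gamma> \<delta>. \<gamma> \<in> R \<Longrightarrow> \<delta> \<in> R \<Longrightarrow> face S i 1 \<gamma> = face S i 0 \<delta> \<Longrightarrow> paste S i \<gamma> \<delta> \<in> R"
  shows "quasiequiv (Faces S i R)"
proof -
  have refl: "(face S i j \<gamma>, face S i j \<gamma>) \<in> Faces S i R" if "\<gamma> \<in> R" "j \<in> {0, 1}" for \<gamma> j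
    using FacesI[OF degen[OF that], of S i] by (simp add: face_degen[OF i that(2)])
  have sym: "(face S i 1 \<gamma>, face S i 0 \<gamma>) \<in> Faces S i R" if "\<gamma> \<in> R" for \<gamma>
    using FacesI[OF flip[OF that], of S i] by (simp add: face_flip[OF i])
  have trans: "(face S i 0 \<gamma>, face S i 1 \<delta>) \<in> Faces S i R"
    if "\<gamma> \<in> R" "\<delta> \<in> R" "face S i 1 \<gamma> = face S i 0 \<delta>" for \<gamma> \<delta>
    using FacesI[OF paste[OF that], of S i] by (simp add: face_paste[OF i])
  show ?thesis
    unfolding quasiequiv_def
  proof (intro conjI allI impI symI transI)
    fix a b assume "(a, b) \<in> Faces S i R"
    then obtain \<gamma> where "\<gamma> \<in> R" "a = face S i 0 \<gamma>" "b = face S i 1 \<gamma>"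
      by (rule FacesE)
    then show "(a, a) \<in> Faces S i R" "(b, b) \<in> Faces S i R" "(b, a) \<in> Faces S i R"
      using refl[of \<gamma> 0] refl[of \<gamma> 1] sym[of \<gamma>] by simp_all
  next
    fix a b c assume ab: "(a, b) \<in> Faces S i R" and bc: "(b, c) \<in> Faces S i R"
    obtain \<gamma> where "\<gamma> \<in> R" "a = face S i 0 \<gamma>" "b = face S i 1 \<gamma>"
      using ab by (rule FacesE)
    moreover obtain \<delta> where "\<delta> \<in> R" "b = face S i 0 \<delta>" "c = face S i 1 \<delta>"
      using bc by (rule FacesE)
    ultimately show "(a, c) \<in> Faces S i R" using trans[of \<gamma> \<delta>] by simp
  qed
qed

lemma quasiequiv_Faces_paste:
  assumes R: "R \<subseteq> cubes S A" and i: "i \<in> S" and q: "quasiequiv (Faces S i R)"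
    and \<gamma>: "\<gamma> \<in> R" and \<delta>: "\<delta> \<in> R" and eq: "face S i 1 \<gamma> = face S i 0 \<delta>"
  shows "paste S i \<gamma> \<delta> \<in> R"
proof -
  have "(face S i 0 \<gamma>, face S i 1 \<gamma>) \<in> Faces S i R" "(face S i 1 \<gamma>, face S i 1 \<delta>) \<in> Faces S i R"
    using FacesI[OF \<gamma>, of S i] FacesI[OF \<delta>, of S i] by (simp_all add: eq)
  moreover have "trans (Faces S i R)" using q by (simp add: quasiequiv_def)
  ultimately have "(face S i 0 \<gamma>, face S i 1 \<delta>) \<in> Faces S i R"
    by (rule transD[rotated])
  then obtain \<epsilon> where \<epsilon>: "\<epsilon> \<in> R" "face S i 0 \<gamma> = face S i 0 \<epsilon>" "face S i 1 \<delta> = face S i 1 \<epsilon>"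
    by (rule FacesE)
  have "paste S i \<gamma> \<delta> = \<epsilon>"
  proof (rule cube_eqI[OF i])
    show "paste S i \<gamma> \<delta> \<in> cubes S A" 
      by (rule paste_cubes) (rule subsetD[OF R], fact)+
    show "\<epsilon> \<in> cubes S A" using \<epsilon>(1) by (rule subsetD[OF R])
  qed (use \<epsilon>(2,3) in \<open>simp_all add: face_paste[OF i]\<close>)
  then show ?thesis using \<epsilon>(1) by (simp only:)
qed

text \<open>
  Only transitivity is added. The sets to which this is applied are already closed under \<open>degen\<close>
  and \<open>flip\<close>, and the next lemmas show that pasting preserves this. Keeping the two out of
  the definition matters: an induction for \<open>pasting_closure_op\<close> with a step for \<open>degen\<close> would not go
  through, since an operation applied to one degenerate and several arbitrary cubes need not give a
  degenerate cube.
\<close>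

inductive_set pasting_closure :: "nat set \<Rightarrow> ((nat \<Rightarrow> nat) \<Rightarrow> 'a) set \<Rightarrow> ((nat \<Rightarrow> nat) \<Rightarrow> 'a) set"
  for S X where
  base: "\<gamma> \<in> X \<Longrightarrow> \<gamma> \<in> pasting_closure S X"
| paste: "i \<in> S \<Longrightarrow> \<gamma> \<in> pasting_closure S X \<Longrightarrow> \<delta> \<in> pasting_closure S X \<Longrightarrow>
    face S i 1 \<gamma> = face S i 0 \<delta> \<Longrightarrow> paste S i \<gamma> \<delta> \<in> pasting_closure S X"

lemma pasting_closure_cubes:
  assumes "X \<subseteq> cubes S A"
  shows "pasting_closure S X \<subseteq> cubes S A"
proof
  fix \<gamma> assume "\<gamma> \<in> pasting_closure S X"
  then show "\<gamma> \<in> cubes S A"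
  proof induction
    case (base \<gamma>)
    then show ?case by (rule subsetD[OF assms])
  next
    case (paste i \<gamma> \<delta>)
    show ?case using paste.IH by (rule paste_cubes)
  qed
qed

text \<open>
  In the direction \<open>i\<close> a pasting degenerates to a degeneration of one of its two parts; in any
  other direction degeneration distributes over pasting.
\<close>

lemma pasting_closure_degen:
  assumes i: "i \<in> S" and j: "j \<in> {0, 1}"
    and X: "\<And>\<gamma>. \<gamma> \<in> X \<Longrightarrow> degen S i j \<gamma> \<in> X"
    and "\<gamma> \<in> pasting_closure S X"
  shows "degen S i j \<gamma> \<in> pasting_closure S X"
  using assms(4)
proof induction
  case (paste i' \<gamma> \<delta>)
  show ?case
  proof (cases "i' = i")
    case True
    have "degen S i j (paste S i' \<gamma> \<delta>) = (if j = 0 then degen S i j \<gamma> else degen S i j \<delta>)"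
      using True i j by (auto simp: degen_def paste_def vertex_upd)
    then show ?thesis using paste by (cases "j = 0") simp_all
  next
    case False
    have "degen S i j (paste S i' \<gamma> \<delta>) = paste S i' (degen S i j \<gamma>) (degen S i j \<delta>)"
      unfolding degen_def paste_def
      by (rule restrict_ext) (use False vertex_upd[OF _ i j] in simp)
    moreover have "face S i' 1 (degen S i j \<gamma>) = face S i' 0 (degen S i j \<delta>)"
      using paste.hyps i j False unfolding face_eq_iff[OF paste.hyps(1)]
      by (simp add: degen_def vertex_upd fun_upd_twist[of i'])
    ultimately show ?thesis using paste by (simp add: pasting_closure.paste)
  qed
qed (use X in \<open>auto intro: pasting_closure.base\<close>)

text \<open>
  Flipping distributes over pasting, and exchanges the two parts if the directions agree.
\<close>

lemma pasting_closure_flip: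
  assumes i: "i \<in> S"
    and X: "\<And>\<gamma>. \<gamma> \<in> X \<Longrightarrow> flip S i \<gamma> \<in> X"
    and "\<gamma> \<in> pasting_closure S X"
  shows "flip S i \<gamma> \<in> pasting_closure S X"
  using assms(3)
proof induction
  case (paste i' \<gamma> \<delta>)
  have upd: "v(i := 1 - v i) \<in> vertices S" if "v \<in> vertices S" for v
    using that i by (intro vertex_upd) auto
  show ?case
  proof (cases "i' = i")
    case True
    have "flip S i (paste S i' \<gamma> \<delta>) = paste S i' (flip S i \<delta>) (flip S i \<gamma>)"
    proof
      fix v
      have "v \<in> vertices S \<Longrightarrow> v i = 0 \<or> v i = 1" using i by auto
      then show "flip S i (paste S i' \<gamma> \<delta>) v = paste S i' (flip S i \<delta>) (flip S i \<gamma>) v"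
        using True upd[of v] by (auto simp: flip_def paste_def)
    qed
    moreover have "face S i' 1 (flip S i \<delta>) = face S i' 0 (flip S i \<gamma>)"
      using paste.hyps True by (simp add: face_flip)
    ultimately show ?thesis using paste by (simp add: pasting_closure.paste)
  next
    case False
    have "flip S i (paste S i' \<gamma> \<delta>) = paste S i' (flip S i \<gamma>) (flip S i \<delta>)"
    proof
      fix v
      show "flip S i (paste S i' \<gamma> \<delta>) v = paste S i' (flip S i \<gamma>) (flip S i \<delta>) v"
        using False upd[of v] by (auto simp: flip_def paste_def)
    qed
    moreover have "face S i' 1 (flip S i \<gamma>) = face S i' 0 (flip S i \<delta>)"
      unfolding face_eq_iff[OF paste.hyps(1)]
    proof
      fix v assume v: "v \<in> vertices S"
      have "\<gamma> ((v(i := 1 - v i))(i' := 1)) = \<delta> ((v(i := 1 - v i))(i' := 0))"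
        using paste.hyps(4) upd[OF v] unfolding face_eq_iff[OF paste.hyps(1)] by blast
      then show "flip S i \<gamma> (v(i' := 1)) = flip S i \<delta> (v(i' := 0))"
        using False v paste.hyps(1) by (simp add: flip_def vertex_upd fun_upd_twist[of i'])
    qed
    ultimately show ?thesis using paste by (simp add: pasting_closure.paste)
  qed
qed (use X in \<open>auto intro: pasting_closure.base\<close>)

text \<open>
  The arguments are moved from \<open>X\<close> to its closure one after another: the outer induction counts the
  arguments that have been moved already, the inner one follows the construction of the next one.
  A pasting \<open>c\<close>, \<open>d\<close> in that argument splits the value into the value at \<open>c\<close> with the
  other arguments unchanged, and the value at \<open>d\<close> with the other arguments replaced by their
  degenerate upper faces. The arguments that are still in \<open>X\<close> stay there, because \<open>X\<close> is
  closed under degeneration.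
\<close>

lemma pasting_closure_op:
  fixes F :: "(nat \<Rightarrow> 'a) \<Rightarrow> 'a"
  assumes degen: "\<And>i \<gamma>. i \<in> S \<Longrightarrow> \<gamma> \<in> X \<Longrightarrow> degen S i 1 \<gamma> \<in> X"
    and X: "\<And>\<gamma>. (\<And>j. j < n \<Longrightarrow> \<gamma> j \<in> X) \<Longrightarrow>
      (\<lambda>v\<in>vertices S. F (\<lambda>j\<in>{..<n}. \<gamma> j v)) \<in> pasting_closure S X"
    and \<gamma>: "\<And>j. j < n \<Longrightarrow> \<gamma> j \<in> pasting_closure S X"
  shows "(\<lambda>v\<in>vertices S. F (\<lambda>j\<in>{..<n}. \<gamma> j v)) \<in> pasting_closure S X"
proof -
  define app where "app \<gamma> = (\<lambda>v\<in>vertices S. F (\<lambda>j\<in>{..<n}. \<gamma> j v))" for \<gamma>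
  have "app \<gamma> \<in> pasting_closure S X"
    if "m \<le> n" and "\<And>j. j < m \<Longrightarrow> \<gamma> j \<in> pasting_closure S X"
      and "\<And>j. m \<le> j \<Longrightarrow> j < n \<Longrightarrow> \<gamma> j \<in> X" for m \<gamma>
    using that
  proof (induction m arbitrary: \<gamma>)
    case 0
    then show ?case unfolding app_def by (intro X) simp
  next
    case (Suc m)
    have "app (\<gamma>(m := c)) \<in> pasting_closure S X"
      if "c \<in> pasting_closure S X" and "\<And>j. j < m \<Longrightarrow> \<gamma> j \<in> pasting_closure S X"
        and "\<And>j. m < j \<Longrightarrow> j < n \<Longrightarrow> \<gamma> j \<in> X" for c \<gamma>
      using that
    proof (induction c arbitrary: \<gamma>)
      case (base c)
      show ?case
        by (rule Suc.IH) (use base Suc.prems(1) in auto)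
    next
      case (paste i c d)
      let ?\<delta> = "\<lambda>j. degen S i 1 (\<gamma> j)"
      have vi: "v(i := v i) = v" for v :: "nat \<Rightarrow> nat" by simp
      have "app (\<gamma>(m := paste S i c d)) = paste S i (app (\<gamma>(m := c))) (app (?\<delta>(m := d)))"
      proof
        fix v
        show "app (\<gamma>(m := paste S i c d)) v = paste S i (app (\<gamma>(m := c))) (app (?\<delta>(m := d))) v"
        proof (cases "v \<in> vertices S \<and> v i \<noteq> 0")
          case True
          then have "v i \<in> {0, 1}" using paste.hyps(1) by (blast dest: PiE_mem)
          then have v1: "v(i := 1) = v" using True by (simp add: fun_upd_idem_iff)
          show ?thesis using True
            by (auto simp: app_def paste_def degen_def v1 intro!: arg_cong[of _ _ F] restrict_ext)
        qed (auto simp: app_def paste_def intro!: arg_cong[of _ _ F] restrict_ext)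
      qed
      moreover have "app (\<gamma>(m := c)) \<in> pasting_closure S X"
        using paste by blast
      moreover have "app (?\<delta>(m := d)) \<in> pasting_closure S X"
        using paste.prems paste.hyps(1)
        by (intro paste.IH(2) pasting_closure_degen) (auto intro: degen)
      moreover have "face S i 1 (app (\<gamma>(m := c))) = face S i 0 (app (?\<delta>(m := d)))"
        using paste.hyps(1,4) unfolding face_eq_iff[OF paste.hyps(1)]
        by (auto simp: app_def degen_def vertex_upd intro!: arg_cong[of _ _ F] restrict_ext)
      ultimately show ?case using pasting_closure.paste[OF paste.hyps(1)] by (simp only:)
    qed
    from this[of "\<gamma> m" \<gamma>] Suc.prems show ?case by simp
  qed
  from this[of n \<gamma>] \<gamma> show ?thesis by (simp add: app_def)
qed

section \<open>Cubes of polynomials\<close>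

definition poly_cube ::
  "nat set \<Rightarrow> 'i set \<Rightarrow> (('i \<Rightarrow> 'a) \<Rightarrow> 'a) \<Rightarrow> ('i \<Rightarrow> nat) \<Rightarrow> ('i \<Rightarrow> 'a) \<Rightarrow> ('i \<Rightarrow> 'a) \<Rightarrow> ((nat \<Rightarrow> nat) \<Rightarrow> 'a)"
  where "poly_cube S I p \<sigma> x y = (\<lambda>v\<in>vertices S. p (\<lambda>l\<in>I. if v (\<sigma> l) = 0 then x l else y l))"

text \<open>
  The map \<open>\<sigma>\<close> assigns to each variable its direction. It is arbitrary, so that neither an
  enumeration of \<open>S\<close> nor the use of all directions is imposed; the set depends on the algebra
  only through \<open>P\<close>.
\<close>

definition poly_cubes ::
  "nat set \<Rightarrow> (nat \<Rightarrow> ('a \<times> 'a) set) \<Rightarrow> nat \<Rightarrow> ((nat \<Rightarrow> 'a) \<Rightarrow> 'a) set \<Rightarrow> ((nat \<Rightarrow> nat) \<Rightarrow> 'a) set"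
  where "poly_cubes S \<theta> k P = {poly_cube S {..<k} p \<sigma> x y | p \<sigma> x y.
    p \<in> P \<and> (\<forall>l<k. \<sigma> l \<in> S \<and> (x l, y l) \<in> \<theta> (\<sigma> l))}"

lemma poly_cubesI:
  "p \<in> P \<Longrightarrow> (\<And>l. l < k \<Longrightarrow> \<sigma> l \<in> S) \<Longrightarrow> (\<And>l. l < k \<Longrightarrow> (x l, y l) \<in> \<theta> (\<sigma> l)) \<Longrightarrow>
   poly_cube S {..<k} p \<sigma> x y \<in> poly_cubes S \<theta> k P"
  unfolding poly_cubes_def by blast

lemma poly_cubes_degen:
  assumes \<theta>: "\<And>i. i \<in> S \<Longrightarrow> equiv A (\<theta> i)" and i: "i \<in> S" and j: "j \<in> {0, 1}"
    and \<gamma>: "\<gamma> \<in> poly_cubes S \<theta> k P"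
  shows "degen S i j \<gamma> \<in> poly_cubes S \<theta> k P"
proof -
  obtain p \<sigma> x y where p: "p \<in> P" "\<And>l. l < k \<Longrightarrow> \<sigma> l \<in> S"
    "\<And>l. l < k \<Longrightarrow> (x l, y l) \<in> \<theta> (\<sigma> l)" and \<gamma>: "\<gamma> = poly_cube S {..<k} p \<sigma> x y"
    using \<gamma> unfolding poly_cubes_def by blast
  let ?c = "\<lambda>l. if j = 0 then x l else y l"
  let ?x = "\<lambda>l. if \<sigma> l = i then ?c l else x l" and ?y = "\<lambda>l. if \<sigma> l = i then ?c l else y l"
  have "degen S i j \<gamma> = poly_cube S {..<k} p \<sigma> ?x ?y"
  proof
    fix v show "degen S i j \<gamma> v = poly_cube S {..<k} p \<sigma> ?x ?y v"
    proof (cases "v \<in> vertices S")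
      case v: True
      have "(\<lambda>l\<in>{..<k}. if (v(i := j)) (\<sigma> l) = 0 then x l else y l) =
          (\<lambda>l\<in>{..<k}. if v (\<sigma> l) = 0 then ?x l else ?y l)"
        by (rule restrict_ext) auto
      then show ?thesis
        using v vertex_upd[OF v i j] by (simp add: \<gamma> degen_def poly_cube_def)
    qed (simp add: degen_def poly_cube_def)
  qed
  moreover have "(?x l, ?y l) \<in> \<theta> (\<sigma> l)" if "l < k" for l
    using p(3)[OF that] \<theta>[OF p(2)[OF that]]
    by (auto simp: equiv_def refl_on_def)
  ultimately show ?thesis
    using p by (simp add: poly_cubesI)
qed

lemma poly_cubes_flip:
  assumes \<theta>: "\<And>i. i \<in> S \<Longrightarrow> equiv A (\<theta> i)" and i: "i \<in> S"
    and \<gamma>: "\<gamma> \<in> poly_cubes S \<theta> k P"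
  shows "flip S i \<gamma> \<in> poly_cubes S \<theta> k P"
proof -
  obtain p \<sigma> x y where p: "p \<in> P" "\<And>l. l < k \<Longrightarrow> \<sigma> l \<in> S"
    "\<And>l. l < k \<Longrightarrow> (x l, y l) \<in> \<theta> (\<sigma> l)" and \<gamma>: "\<gamma> = poly_cube S {..<k} p \<sigma> x y"
    using \<gamma> unfolding poly_cubes_def by blast
  let ?x = "\<lambda>l. if \<sigma> l = i then y l else x l" and ?y = "\<lambda>l. if \<sigma> l = i then x l else y l"
  have upd: "v(i := 1 - v i) \<in> vertices S" "v i = 0 \<or> v i = 1" if "v \<in> vertices S" for v
  proof -
    show "v(i := 1 - v i) \<in> vertices S" using that i by (rule vertex_upd) auto
    show "v i = 0 \<or> v i = 1" using PiE_mem[OF that i] by simp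
  qed
  have "flip S i \<gamma> = poly_cube S {..<k} p \<sigma> ?x ?y"
  proof
    fix v show "flip S i \<gamma> v = poly_cube S {..<k} p \<sigma> ?x ?y v"
    proof (cases "v \<in> vertices S")
      case v: True
      have "(\<lambda>l\<in>{..<k}. if (v(i := 1 - v i)) (\<sigma> l) = 0 then x l else y l) =
          (\<lambda>l\<in>{..<k}. if v (\<sigma> l) = 0 then ?x l else ?y l)"
        by (rule restrict_ext) (use upd(2)[OF v] in auto)
      then show ?thesis
        using v upd(1)[OF v] by (simp add: \<gamma> flip_def poly_cube_def)
    qed (simp add: flip_def poly_cube_def)
  qed
  moreover have "(?x l, ?y l) \<in> \<theta> (\<sigma> l)" if "l < k" for l
    using p(3)[OF that] \<theta>[OF p(2)[OF that]]
    by (auto simp: equiv_def sym_def)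
  ultimately show ?thesis
    using p by (simp add: poly_cubesI)
qed

text \<open>
  If at most \<open>k\<close> variables really vary, an injection \<open>e\<close> renames these to variables below \<open>k\<close>, and
  all others become constants.
\<close>

lemma poly_cube_Pol:
  fixes N :: "'i set"
  assumes alg: "is_algebra \<A>" and \<theta>: "\<And>i. i \<in> S \<Longrightarrow> equiv (carrier \<A>) (\<theta> i)"
    and S: "S \<noteq> {}" and t: "t \<in> polynomials \<A> N"
    and \<sigma>: "\<And>l. l \<in> N \<Longrightarrow> \<sigma> l \<in> S" and ab: "\<And>l. l \<in> N \<Longrightarrow> (a l, b l) \<in> \<theta> (\<sigma> l)"
    and N: "finite N" and active: "card {l \<in> N. a l \<noteq> b l} \<le> k"
  shows "poly_cube S N t \<sigma> a b \<in> poly_cubes S \<theta> k (Pol k \<A>)"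
proof -
  let ?M = "{l \<in> N. a l \<noteq> b l}"
  have A: "a l \<in> carrier \<A>" "b l \<in> carrier \<A>" if "l \<in> N" for l
    using ab[OF that] \<theta>[OF \<sigma>[OF that]] by (auto simp: equiv_def refl_on_def)
  obtain e where e: "inj_on e ?M" "e ` ?M \<subseteq> {..<k}"
    using card_le_inj[of ?M "{..<k}"] N active by auto
  define d where "d = inv_into ?M e"
  have d: "d (e l) = l" if "l \<in> ?M" for l
    unfolding d_def by (rule inv_into_f_f[OF e(1) that])
  obtain i where i: "i \<in> S" using S by blast
  \<comment> \<open>the variables below \<open>k\<close> outside the range of \<open>e\<close> need some value \<open>c\<close>; the carrier is nonempty because \<open>t\<close> has a value\<close>
  have "t a \<in> carrier \<A>" by (rule polynomials_closed[OF alg t A(1)])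
  then obtain c where c: "c \<in> carrier \<A>" by blast
  then have cc: "(c, c) \<in> \<theta> i" using \<theta>[OF i] by (auto simp: equiv_def refl_on_def)
  let ?E = "e ` ?M"
  define \<sigma>' where "\<sigma>' m = (if m \<in> ?E then \<sigma> (d m) else i)" for m
  define x where "x m = (if m \<in> ?E then a (d m) else c)" for m
  define y where "y m = (if m \<in> ?E then b (d m) else c)" for m
  define s :: "'i \<Rightarrow> (nat \<Rightarrow> 'b) \<Rightarrow> 'b" where "s l = (if l \<in> ?M then (\<lambda>z. z (e l)) else (\<lambda>z. a l))" for l
  have "s l \<in> polynomials \<A> {..<k}" if "l \<in> N" for l
    using e(2) A(1)[OF that] by (auto simp: s_def intro: polynomials.var polynomials.const)
  then have u: "(\<lambda>z. t (\<lambda>l. s l z)) \<in> polynomials \<A> {..<k}"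
    by (rule polynomials_subst[OF t])
  let ?p = "\<lambda>z\<in>tuples (carrier \<A>) k. t (\<lambda>l. s l z)"
  have p: "?p \<in> Pol k \<A>" unfolding Pol_eq using u by (rule imageI)
  have \<sigma>': "\<sigma>' m \<in> S" for m
    using \<sigma> i d by (auto simp: \<sigma>'_def)
  have xy: "(x m, y m) \<in> \<theta> (\<sigma>' m)" for m
    using ab cc d by (auto simp: \<sigma>'_def x_def y_def)
  then have xyA: "x m \<in> carrier \<A>" "y m \<in> carrier \<A>" for m
    using \<theta>[OF \<sigma>'[of m]] xy[of m] by (auto simp: equiv_def refl_on_def)
  have "poly_cube S N t \<sigma> a b = poly_cube S {..<k} ?p \<sigma>' x y"
    unfolding poly_cube_def
  proof (rule restrict_ext)
    fix v assume "v \<in> vertices S"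
    let ?z = "\<lambda>m\<in>{..<k}. if v (\<sigma>' m) = 0 then x m else y m"
    have z: "?z \<in> tuples (carrier \<A>) k" using xyA by auto
    have "t (\<lambda>l\<in>N. if v (\<sigma> l) = 0 then a l else b l) = t (\<lambda>l. s l ?z)"
    proof (rule polynomials_cong[OF t])
      fix l assume l: "l \<in> N"
      show "(\<lambda>l\<in>N. if v (\<sigma> l) = 0 then a l else b l) l = s l ?z"
      proof (cases "l \<in> ?M")
        case True
        then have el: "e l \<in> ?E" "e l < k" using e(2) by blast+
        then show ?thesis using True d[OF True] l
          by (simp add: s_def \<sigma>'_def x_def y_def del: mem_Collect_eq)
      next
        case False
        then show ?thesis using l by (auto simp: s_def)
      qed
    qed
    then show "t (\<lambda>l\<in>N. if v (\<sigma> l) = 0 then a l else b l) = ?p ?z" using z by simp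
  qed
  then show ?thesis using p \<sigma>' xy by (simp add: poly_cubesI)
qed

text \<open>
  The induction is on the number of variables that really vary. With more of them than directions,
  two, \<open>l\<close> and \<open>l'\<close>, share a direction \<open>i\<close>. The first of the two pasted cubes moves everything
  except \<open>l\<close>; the second one starts, in direction \<open>i\<close>, where the first ends, and moves only \<open>l\<close> in this
  direction. So \<open>l\<close> is at rest in the first cube and \<open>l'\<close> in the second.
\<close>

lemma poly_cube_in_pasting_closure:
  fixes N :: "'i set"
  assumes alg: "is_algebra \<A>" and \<theta>: "\<And>i. i \<in> S \<Longrightarrow> equiv (carrier \<A>) (\<theta> i)"
    and S: "S \<noteq> {}" "finite S" and t: "t \<in> polynomials \<A> N"
    and \<sigma>: "\<And>l. l \<in> N \<Longrightarrow> \<sigma> l \<in> S" and ab: "\<And>l. l \<in> N \<Longrightarrow> (a l, b l) \<in> \<theta> (\<sigma> l)"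
    and N: "finite N"
  shows "poly_cube S N t \<sigma> a b \<in> pasting_closure S (poly_cubes S \<theta> (card S) (Pol (card S) \<A>))"
  using ab
proof (induction "card {l \<in> N. a l \<noteq> b l}" arbitrary: a b rule: less_induct)
  case less
  let ?M = "\<lambda>a b. {l \<in> N. a l \<noteq> b l}"
  show ?case
  proof (cases "card (?M a b) \<le> card S")
    case True
    show ?thesis
      by (rule pasting_closure.base, rule poly_cube_Pol[OF alg \<theta> S(1) t \<sigma> less.prems N True])
  next
    case False
    have "\<sigma> ` ?M a b \<subseteq> S" using \<sigma> by auto
    then have "card (\<sigma> ` ?M a b) \<le> card S" by (rule card_mono[OF S(2)])
    then have "card (\<sigma> ` ?M a b) < card (?M a b)" using False by linarith
    then have "\<not> inj_on \<sigma> (?M a b)" by (rule pigeonhole)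
    then obtain l l' where l: "l \<in> ?M a b" "l' \<in> ?M a b" "l \<noteq> l'" "\<sigma> l = \<sigma> l'"
      unfolding inj_on_def by blast
    define i where "i = \<sigma> l"
    have i: "i \<in> S" using l \<sigma> by (simp add: i_def)
    let ?b = "b(l := a l)"
    let ?a = "\<lambda>m. if \<sigma> m = i \<and> m \<noteq> l then b m else a m"
    have refl: "(a m, a m) \<in> \<theta> (\<sigma> m)" "(b m, b m) \<in> \<theta> (\<sigma> m)" if "m \<in> N" for m
      using less.prems[OF that] \<theta>[OF \<sigma>[OF that]] by (auto simp: equiv_def refl_on_def)
    have "?M a ?b \<subset> ?M a b"
    proof (rule psubsetI)
      show "?M a ?b \<noteq> ?M a b" using l(1) by (metis (mono_tags, lifting) fun_upd_same mem_Collect_eq)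
    qed auto
    moreover have "?M ?a b \<subset> ?M a b"
    proof (rule psubsetI)
      have "l' \<notin> ?M ?a b" using l(3,4) by (simp add: i_def)
      then show "?M ?a b \<noteq> ?M a b" using l(2) by metis
    qed auto
    moreover have "finite (?M a b)" using N by simp
    ultimately have smaller: "card (?M a ?b) < card (?M a b)" "card (?M ?a b) < card (?M a b)"
      by (simp_all only: psubset_card_mono)
    have pairs: "(a m, ?b m) \<in> \<theta> (\<sigma> m)" "(?a m, b m) \<in> \<theta> (\<sigma> m)" if "m \<in> N" for m
      using less.prems[OF that] refl[OF that] by (cases "m = l"; cases "\<sigma> m = i"; simp)+
    have "poly_cube S N t \<sigma> a ?b \<in> pasting_closure S (poly_cubes S \<theta> (card S) (Pol (card S) \<A>))"
      by (rule less.hyps[OF smaller(1) pairs(1)])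
    moreover have "poly_cube S N t \<sigma> ?a b \<in> pasting_closure S (poly_cubes S \<theta> (card S) (Pol (card S) \<A>))"
      by (rule less.hyps[OF smaller(2) pairs(2)])
    moreover have "face S i 1 (poly_cube S N t \<sigma> a ?b) = face S i 0 (poly_cube S N t \<sigma> ?a b)"
      unfolding face_eq_iff[OF i]
    proof
      fix v assume v: "v \<in> vertices S"
      have "(\<lambda>m\<in>N. if (v(i := 1)) (\<sigma> m) = 0 then a m else ?b m) =
          (\<lambda>m\<in>N. if (v(i := 0)) (\<sigma> m) = 0 then ?a m else b m)"
        by (rule restrict_ext) (simp add: i_def)
      then show "poly_cube S N t \<sigma> a ?b (v(i := 1)) = poly_cube S N t \<sigma> ?a b (v(i := 0))"
        using vertex_upd[OF v i] by (simp add: poly_cube_def)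
    qed
    ultimately have "paste S i (poly_cube S N t \<sigma> a ?b) (poly_cube S N t \<sigma> ?a b)
        \<in> pasting_closure S (poly_cubes S \<theta> (card S) (Pol (card S) \<A>))"
      by (rule pasting_closure.paste[OF i])
    moreover have "poly_cube S N t \<sigma> a b = paste S i (poly_cube S N t \<sigma> a ?b) (poly_cube S N t \<sigma> ?a b)"
    proof
      fix v :: "nat \<Rightarrow> nat"
      have "v i = 0 \<Longrightarrow> (\<lambda>m\<in>N. if v (\<sigma> m) = 0 then a m else b m) =
          (\<lambda>m\<in>N. if v (\<sigma> m) = 0 then a m else ?b m)"
        "v i \<noteq> 0 \<Longrightarrow> (\<lambda>m\<in>N. if v (\<sigma> m) = 0 then a m else b m) =
          (\<lambda>m\<in>N. if v (\<sigma> m) = 0 then ?a m else b m)"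
        by (auto intro!: restrict_ext simp: i_def)
      then show "poly_cube S N t \<sigma> a b v =
          paste S i (poly_cube S N t \<sigma> a ?b) (poly_cube S N t \<sigma> ?a b) v"
        by (simp add: poly_cube_def paste_def)
    qed
    ultimately show ?thesis by (simp only:)
  qed
qed

section \<open>The relation \<open>\<Delta>\<close>\<close>

lemma dim_congruence_polynomial:
  assumes R: "dim_congruence \<A> S R"
    and const: "\<And>c. c \<in> carrier \<A> \<Longrightarrow> (\<lambda>v\<in>vertices S. c) \<in> R"
    and t: "t \<in> polynomials \<A> I" and \<gamma>: "\<And>l. l \<in> I \<Longrightarrow> \<gamma> l \<in> R"
  shows "(\<lambda>v\<in>vertices S. t (\<lambda>l. \<gamma> l v)) \<in> R"
  using t
proof induction
  case (var i)
  have "R \<subseteq> cubes S (carrier \<A>)" using R by (simp add: dim_congruence_def)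
  then have "\<gamma> i \<in> cubes S (carrier \<A>)" by (rule subsetD) (rule \<gamma>[OF var])
  then have "(\<lambda>v\<in>vertices S. \<gamma> i v) = \<gamma> i" by (auto simp: PiE_iff extensional_restrict)
  then show ?case using \<gamma>[OF var] by simp
next
  case (comp f t)
  let ?n = "arity \<A> f"
  let ?\<delta> = "\<lambda>j\<in>{..<?n}. \<lambda>v\<in>vertices S. t j (\<lambda>l. \<gamma> l v)"
  have "?\<delta> \<in> tuples R ?n"
  proof (rule PiE_I)
    fix j assume j: "j \<in> {..<?n}"
    show "?\<delta> j \<in> R"
      unfolding restrict_apply'[OF j] by (rule comp.IH) (use j in simp)
  qed simp
  then have "(\<lambda>v\<in>vertices S. interp \<A> f (\<lambda>j\<in>{..<?n}. ?\<delta> j v)) \<in> R"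
    by (rule R[unfolded dim_congruence_def, THEN conjunct2, THEN conjunct2, rule_format,
        OF comp.hyps(1)])
  moreover have "(\<lambda>v\<in>vertices S. interp \<A> f (\<lambda>j\<in>{..<?n}. ?\<delta> j v)) =
      (\<lambda>v\<in>vertices S. interp \<A> f (\<lambda>j\<in>{..<?n}. t j (\<lambda>l. \<gamma> l v)))"
    by (intro restrict_ext arg_cong[of _ _ "interp \<A> f"]) auto
  ultimately show ?case by (simp only:)
next
  case (const a)
  then show ?case by (rule assms(2))
qed

lemma poly_cubes_subset_dim_congruence:
  assumes \<theta>: "\<And>i. i \<in> S \<Longrightarrow> equiv (carrier \<A>) (\<theta> i)" and S: "S \<noteq> {}"
    and R: "dim_congruence \<A> S R"
    and gen: "\<And>i x y. i \<in> S \<Longrightarrow> (x, y) \<in> \<theta> i \<Longrightarrow> cube S i x y \<in> R"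
  shows "poly_cubes S \<theta> k (Pol k \<A>) \<subseteq> R"
proof
  fix \<gamma> assume "\<gamma> \<in> poly_cubes S \<theta> k (Pol k \<A>)"
  then obtain p \<sigma> x y where p: "p \<in> Pol k \<A>" and \<sigma>: "\<And>l. l < k \<Longrightarrow> \<sigma> l \<in> S"
    and xy: "\<And>l. l < k \<Longrightarrow> (x l, y l) \<in> \<theta> (\<sigma> l)" and \<gamma>: "\<gamma> = poly_cube S {..<k} p \<sigma> x y"
    unfolding poly_cubes_def by blast
  obtain t where t: "t \<in> polynomials \<A> {..<k}" and pt: "p = (\<lambda>x\<in>tuples (carrier \<A>) k. t x)"
    using p unfolding Pol_eq by (rule imageE)
  have A: "x l \<in> carrier \<A>" "y l \<in> carrier \<A>" if "l < k" for l
    using xy[OF that] \<theta>[OF \<sigma>[OF that]] by (auto simp: equiv_def refl_on_def)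
  have const: "(\<lambda>v\<in>vertices S. c) \<in> R" if "c \<in> carrier \<A>" for c
  proof -
    obtain i where i: "i \<in> S" using S by blast
    have "cube S i c c = (\<lambda>v\<in>vertices S. c)" by (auto simp: cube_def)
    then show ?thesis using gen[OF i, of c c] \<theta>[OF i] that by (auto simp: equiv_def refl_on_def)
  qed
  have "\<gamma> = (\<lambda>v\<in>vertices S. t (\<lambda>l. cube S (\<sigma> l) (x l) (y l) v))"
    unfolding \<gamma> poly_cube_def
  proof (rule restrict_ext)
    fix v assume v: "v \<in> vertices S"
    let ?z = "\<lambda>l\<in>{..<k}. if v (\<sigma> l) = 0 then x l else y l"
    have "?z \<in> tuples (carrier \<A>) k" using A by auto
    moreover have "t ?z = t (\<lambda>l. cube S (\<sigma> l) (x l) (y l) v)"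
      using v by (intro polynomials_cong[OF t]) (auto simp: cube_def)
    ultimately show "p ?z = t (\<lambda>l. cube S (\<sigma> l) (x l) (y l) v)" by (simp add: pt)
  qed
  also have "\<dots> \<in> R"
    by (rule dim_congruence_polynomial[OF R const t]) (use gen \<sigma> xy in auto)
  finally show "\<gamma> \<in> R" .
qed

text \<open>
  The operation combines polynomials in \<open>k\<close> variables each. The variables of different arguments
  may have different directions and values, so the \<open>l\<close>-th variable of the \<open>j\<close>-th argument becomes the
  variable \<open>(j, l)\<close> of the combined polynomial.
\<close>

lemma poly_cubes_op:
  assumes alg: "is_algebra \<A>" and \<theta>: "\<And>i. i \<in> S \<Longrightarrow> equiv (carrier \<A>) (\<theta> i)"
    and S: "S \<noteq> {}" "finite S" and f: "f \<in> symbols \<A>"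
    and \<gamma>: "\<And>j. j < arity \<A> f \<Longrightarrow> \<gamma> j \<in> poly_cubes S \<theta> (card S) (Pol (card S) \<A>)"
  shows "(\<lambda>v\<in>vertices S. interp \<A> f (\<lambda>j\<in>{..<arity \<A> f}. \<gamma> j v))
    \<in> pasting_closure S (poly_cubes S \<theta> (card S) (Pol (card S) \<A>))"
proof -
  let ?n = "arity \<A> f" and ?k = "card S"
  let ?P = "\<lambda>j t \<sigma> x y. t \<in> polynomials \<A> {..<?k} \<and>
    (\<forall>l<?k. \<sigma> l \<in> S \<and> (x l, y l) \<in> \<theta> (\<sigma> l)) \<and>
    \<gamma> j = poly_cube S {..<?k} (\<lambda>x\<in>tuples (carrier \<A>) ?k. t x) \<sigma> x y"
  have "\<forall>j\<in>{..<?n}. \<exists>t \<sigma> x y. ?P j t \<sigma> x y"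
  proof
    fix j assume "j \<in> {..<?n}"
    then have "\<gamma> j \<in> poly_cubes S \<theta> ?k (Pol ?k \<A>)" using \<gamma> by simp
    then show "\<exists>t \<sigma> x y. ?P j t \<sigma> x y" unfolding poly_cubes_def Pol_eq by blast
  qed
  then obtain t where "\<forall>j\<in>{..<?n}. \<exists>\<sigma> x y. ?P j (t j) \<sigma> x y"
    by (rule bchoice[THEN exE])
  then obtain \<sigma> where "\<forall>j\<in>{..<?n}. \<exists>x y. ?P j (t j) (\<sigma> j) x y"
    by (rule bchoice[THEN exE])
  then obtain x where "\<forall>j\<in>{..<?n}. \<exists>y. ?P j (t j) (\<sigma> j) (x j) y"
    by (rule bchoice[THEN exE])
  then obtain y where "\<forall>j\<in>{..<?n}. ?P j (t j) (\<sigma> j) (x j) (y j)"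
    by (rule bchoice[THEN exE])
  then have t: "\<And>j. j < ?n \<Longrightarrow> t j \<in> polynomials \<A> {..<?k}"
    and \<sigma>: "\<And>j l. j < ?n \<Longrightarrow> l < ?k \<Longrightarrow> \<sigma> j l \<in> S"
    and xy: "\<And>j l. j < ?n \<Longrightarrow> l < ?k \<Longrightarrow> (x j l, y j l) \<in> \<theta> (\<sigma> j l)"
    and eq: "\<And>j. j < ?n \<Longrightarrow>
      \<gamma> j = poly_cube S {..<?k} (\<lambda>x\<in>tuples (carrier \<A>) ?k. t j x) (\<sigma> j) (x j) (y j)"
    by simp_all
  have A: "x j l \<in> carrier \<A>" "y j l \<in> carrier \<A>" if "j < ?n" "l < ?k" for j l
    using xy[OF that] \<theta>[OF \<sigma>[OF that]] by (auto simp: equiv_def refl_on_def)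
  let ?N = "{..<?n} \<times> {..<?k}"
  let ?t = "\<lambda>z. interp \<A> f (\<lambda>j\<in>{..<?n}. t j (\<lambda>l. z (j, l)))"
  have u: "?t \<in> polynomials \<A> ?N"
  proof (rule polynomials.comp[OF f])
    fix j assume "j < ?n"
    then show "(\<lambda>z. t j (\<lambda>l. z (j, l))) \<in> polynomials \<A> ?N"
      by (intro polynomials_subst[OF t]) (auto intro: polynomials.var)
  qed
  have "(\<lambda>v\<in>vertices S. interp \<A> f (\<lambda>j\<in>{..<?n}. \<gamma> j v)) =
    poly_cube S ?N ?t (\<lambda>(j, l). \<sigma> j l) (\<lambda>(j, l). x j l) (\<lambda>(j, l). y j l)"
    unfolding poly_cube_def
  proof (intro restrict_ext arg_cong[of _ _ "interp \<A> f"])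
    fix v j assume v: "v \<in> vertices S" and "j \<in> {..<?n}"
    then have j: "j < ?n" by simp
    let ?z = "\<lambda>l\<in>{..<?k}. if v (\<sigma> j l) = 0 then x j l else y j l"
    have "?z \<in> tuples (carrier \<A>) ?k" using A[OF j] by auto
    then have "\<gamma> j v = t j ?z" using v by (simp add: eq[OF j] poly_cube_def)
    also have "\<dots> = t j (\<lambda>l. (\<lambda>q\<in>?N. if v ((\<lambda>(j, l). \<sigma> j l) q) = 0
        then (\<lambda>(j, l). x j l) q else (\<lambda>(j, l). y j l) q) (j, l))"
      using j by (intro polynomials_cong[OF t]) auto
    finally show "\<gamma> j v = \<dots>" .
  qed
  also have "\<dots> \<in> pasting_closure S (poly_cubes S \<theta> ?k (Pol ?k \<A>))"
    by (rule poly_cube_in_pasting_closure[OF alg \<theta> S u]) (use \<sigma> xy in auto)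
  finally show ?thesis .
qed

text \<open>
  The right-hand side depends on \<open>\<A>\<close> only through its \<open>k\<close>-ary polynomials, with \<open>k = card S\<close>. The
  closure is a higher dimensional congruence by the preceding lemmas, and it contains the
  generators, which are the cubes of the polynomial \<open>z\<close>. Conversely, a higher dimensional congruence with
  the generators contains the constant cubes, as these are \<open>cube\<^sub>i(c, c)\<close>, hence all polynomial
  cubes, and it is closed under pasting by transitivity.
\<close>

lemma Delta_eq_pasting_closure:
  assumes alg: "is_algebra \<A>" and \<theta>: "\<And>i. i \<in> S \<Longrightarrow> \<theta> i \<in> Con \<A>"
    and S: "S \<noteq> {}" "finite S"
  shows "Delta \<A> S \<theta> = pasting_closure S (poly_cubes S \<theta> (card S) (Pol (card S) \<A>))"
proof -
  let ?k = "card S"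
  let ?X = "poly_cubes S \<theta> ?k (Pol ?k \<A>)"
  let ?D = "pasting_closure S ?X"
  let ?G = "\<Union>i\<in>S. {cube S i x y | x y. (x, y) \<in> \<theta> i}"
  have eqv: "equiv (carrier \<A>) (\<theta> i)" if "i \<in> S" for i
    using \<theta>[OF that] by (simp add: Con_def)
  have degen: "degen S i j \<gamma> \<in> ?X" if "i \<in> S" "j \<in> {0, 1}" "\<gamma> \<in> ?X" for i j \<gamma>
    by (rule poly_cubes_degen[OF eqv that])
  have flip: "flip S i \<gamma> \<in> ?X" if "i \<in> S" "\<gamma> \<in> ?X" for i \<gamma>
    by (rule poly_cubes_flip[OF eqv that])
  have X: "?X \<subseteq> cubes S (carrier \<A>)"
  proof
    fix \<gamma> assume "\<gamma> \<in> ?X"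
    then obtain p \<sigma> x y where p: "p \<in> Pol ?k \<A>" and \<sigma>: "\<And>l. l < ?k \<Longrightarrow> \<sigma> l \<in> S"
      and xy: "\<And>l. l < ?k \<Longrightarrow> (x l, y l) \<in> \<theta> (\<sigma> l)" and \<gamma>: "\<gamma> = poly_cube S {..<?k} p \<sigma> x y"
      unfolding poly_cubes_def by blast
    have A: "x l \<in> carrier \<A>" "y l \<in> carrier \<A>" if "l < ?k" for l
      using xy[OF that] eqv[OF \<sigma>[OF that]] by (auto simp: equiv_def refl_on_def)
    have "p z \<in> carrier \<A>" if "z \<in> tuples (carrier \<A>) ?k" for z
    proof -
      obtain t where t: "t \<in> polynomials \<A> {..<?k}" and pt: "p = (\<lambda>x\<in>tuples (carrier \<A>) ?k. t x)"
        using p unfolding Pol_eq by (rule imageE)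
      have "t z \<in> carrier \<A>" by (rule polynomials_closed[OF alg t]) (use that in auto)
      then show ?thesis using that by (simp add: pt)
    qed
    moreover have "(\<lambda>l\<in>{..<?k}. if v (\<sigma> l) = 0 then x l else y l) \<in> tuples (carrier \<A>) ?k"
      for v :: "nat \<Rightarrow> nat"
      using A by auto
    ultimately show "\<gamma> \<in> cubes S (carrier \<A>)" unfolding \<gamma> poly_cube_def
      by (intro PiE_I) simp_all
  qed
  have "dim_congruence \<A> S ?D"
    unfolding dim_congruence_def
  proof (intro conjI ballI)
    show "?D \<subseteq> cubes S (carrier \<A>)" by (rule pasting_closure_cubes[OF X])
    show "quasiequiv (Faces S i ?D)" if i: "i \<in> S" for i
    proof (rule quasiequiv_FacesI[OF i])
      show "degen S i j \<gamma> \<in> ?D" if "\<gamma> \<in> ?D" "j \<in> {0, 1}" for \<gamma> j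
        by (rule pasting_closure_degen[OF i that(2) degen[OF i that(2)] that(1)])
      show "flip S i \<gamma> \<in> ?D" if "\<gamma> \<in> ?D" for \<gamma>
        by (rule pasting_closure_flip[OF i flip[OF i] that])
    qed (rule pasting_closure.paste[OF i])
    show "(\<lambda>v\<in>vertices S. interp \<A> f (\<lambda>j\<in>{..<arity \<A> f}. \<gamma> j v)) \<in> ?D"
      if "f \<in> symbols \<A>" "\<gamma> \<in> tuples ?D (arity \<A> f)" for f \<gamma>
    proof (rule pasting_closure_op)
      show "degen S i 1 \<gamma>' \<in> ?X" if "i \<in> S" "\<gamma>' \<in> ?X" for i \<gamma>'
        using that by (simp add: degen)
      show "(\<lambda>v\<in>vertices S. interp \<A> f (\<lambda>j\<in>{..<arity \<A> f}. \<delta> j v)) \<in> ?D"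
        if "\<And>j. j < arity \<A> f \<Longrightarrow> \<delta> j \<in> ?X" for \<delta>
        by (rule poly_cubes_op[OF alg eqv S \<open>f \<in> symbols \<A>\<close> that])
      show "\<gamma> j \<in> ?D" if "j < arity \<A> f" for j
        using \<open>\<gamma> \<in> tuples ?D (arity \<A> f)\<close> by (rule PiE_mem) (simp add: that)
    qed
  qed
  moreover have "?G \<subseteq> ?D"
  proof
    fix \<gamma> assume "\<gamma> \<in> ?G"
    then obtain i x y where i: "i \<in> S" and xy: "(x, y) \<in> \<theta> i" and \<gamma>: "\<gamma> = cube S i x y" by blast
    let ?t = "\<lambda>z :: unit \<Rightarrow> 'b. z ()"
    have "\<gamma> = poly_cube S UNIV ?t (\<lambda>_. i) (\<lambda>_. x) (\<lambda>_. y)"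
      by (auto simp: \<gamma> cube_def poly_cube_def)
    also have "\<dots> \<in> ?D"
      by (rule poly_cube_in_pasting_closure[OF alg eqv S])
        (use i xy in \<open>auto intro: polynomials.var\<close>)
    finally show "\<gamma> \<in> ?D" .
  qed
  moreover have "?D \<subseteq> R" if R: "dim_congruence \<A> S R" and G: "?G \<subseteq> R" for R
  proof
    have XR: "?X \<subseteq> R"
      by (rule poly_cubes_subset_dim_congruence[OF eqv S(1) R]) (use G in auto)
    fix \<gamma> assume "\<gamma> \<in> ?D"
    then show "\<gamma> \<in> R"
    proof induction
      case (paste i \<gamma> \<delta>)
      have "R \<subseteq> cubes S (carrier \<A>)" "quasiequiv (Faces S i R)"
        using R paste.hyps(1) by (simp_all add: dim_congruence_def)
      then show ?case
        by (rule quasiequiv_Faces_paste[OF _ paste.hyps(1) _ paste.IH paste.hyps(4)])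
    qed (use XR in auto)
  qed
  ultimately show ?thesis
    unfolding Delta_def Theta_def
    by (intro equalityI Inter_lower Inter_greatest CollectI conjI) (simp_all only: mem_Collect_eq)
qed

section \<open>The hypercommutator\<close>

theorem theorem4p4:
  fixes \<A> :: "('f, 'a) ualg" and \<B> :: "('g, 'a) ualg" and k :: nat
  assumes "k \<ge> 2"
    and "is_algebra \<A>" and "is_algebra \<B>"
    and "carrier \<A> = carrier \<B>"
    and "Pol k \<A> = Pol k \<B>"
  shows "\<forall>S::nat set. card S = k \<longrightarrow>
    Con \<A> = Con \<B> \<and>
    (\<forall>\<theta>. (\<forall>i\<in>S. \<theta> i \<in> Con \<A>) \<longrightarrow> hypercommutator \<A> S \<theta> = hypercommutator \<B> S \<theta>)"
proof (intro allI impI conjI)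
  fix S :: "nat set" assume S: "card S = k"
  have k: "k > 0" using assms(1) by simp
  then have S': "S \<noteq> {}" "finite S" using S by (auto intro: card_ge_0_finite)
  show Con: "Con \<A> = Con \<B>"
    using Con_iff_Pol[OF assms(2) k] Con_iff_Pol[OF assms(3) k] assms(4,5) by auto
  fix \<theta> assume \<theta>: "\<forall>i\<in>S. \<theta> i \<in> Con \<A>"
  have "Delta \<A> S \<theta> = Delta \<B> S \<theta>"
    using Delta_eq_pasting_closure[OF assms(2) _ S'] Delta_eq_pasting_closure[OF assms(3) _ S']
      \<theta> Con S assms(5) by simp
  then show "hypercommutator \<A> S \<theta> = hypercommutator \<B> S \<theta>"
    by (simp add: hypercommutator_def Con)
qed

end
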